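(* Let $\mathbb F=\mathbb R$ or $\mathbb C$, and let $D=M^2-1$ if $\mathbb F=\mathbb C$ or let $D=\frac{(M+2)(M-1)}{2}$ if $\mathbb F=\mathbb R$. If $\Phi=\{\phi_j\}_{j=1}^N\in\Omega_{N,M}(\mathbb F)$ is a tight frame, then the frame vectors can be isometrically embedded into the unit sphere in $\mathbb R^D$ via $\phi_j\mapsto y_j\in\mathbb R^D$ such that, for all $j,l\in\{1,\dots,N\}$, we have $$|\langle\phi_j,\phi_l\rangle|^2=\frac1M+\frac{M-1}{M}\langle y_j,y_l\rangle$$ and $$\sum_{j=1}^N y_j=0.$$
   Context: A set of vectors $\Phi=\{\phi_j\}_{j=1}^N\subset\mathbb F^M$ is a (finite) frame for $\mathbb F^M$ if its span is $\mathbb F^M$; here $M$ is the dimension of the span and $N$ is the number of frame vectors. It is unit-norm if $\|\phi_j\|=1$ for all $j$, and tight if there is $A>0$ with $\sum_{j=1}^N\phi_j\phi_j^*=A\,I_M$, where $I_M$ is the $M\times M$ identity matrix. $\Omega_{N,M}(\mathbb F)$ denotes the space of unit-norm frames consisting of $N$ vectors in $\mathbb F^M$. "Isometrically embedded" is understood, up to a global scaling factor, with respect to the Hilbert–Schmidt distance $\|\phi_j\phi_j^*-\phi_l\phi_l^*\|_{H.S.}$ between the rank-one projections, where $\|\phi_j\phi_j^*-\phi_l\phi_l^*\|_{H.S.}^2=2(1-|\langle\phi_j,\phi_l\rangle|^2)$; this is what the displayed inner-product identity expresses for unit vectors $y_j$.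
   Formalization: The formal statement assumes M ≥ 2; for M = 1 one has D = 0, the unit sphere in R^0 is empty, and no embedding of the frame vectors into it exists. *)

theory Defs
  imports "HOL-Analysis.Analysis" "Jordan_Normal_Form.Conjugate"
begin

text \<open>
  Everything is stated over a field type carrying both a norm and a conjugation; it is used at
  the types \<open>real\<close> (where \<open>conjugate\<close> is the identity) and \<open>complex\<close> (where it is \<open>cnj\<close>).
  A finite sequence of vectors is a function on \<open>nat\<close> of which only the values at \<open>1, \<dots>, N\<close> matter.
\<close>

definition hinner :: "'a::{conjugatable_field,real_normed_field}^'m \<Rightarrow> 'a^'m \<Rightarrow> 'a" where
  "hinner x y = (\<Sum>i\<in>UNIV. x $ i * conjugate (y $ i))"

text \<open>The matrix \<open>x x\<^sup>*\<close>, the orthogonal projection onto the line through \<open>x\<close> if \<open>x\<close> is a unit vector.\<close>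

definition rank1 :: "'a::{conjugatable_field,real_normed_field}^'m \<Rightarrow> 'a^'m^'m" where
  "rank1 x = (\<chi> i j. x $ i * conjugate (x $ j))"

text \<open>Here \<open>vec.span\<close> is the span with respect to the scalar field \<open>'a\<close>, not just over the reals.\<close>

definition is_frame :: "nat \<Rightarrow> (nat \<Rightarrow> 'a::real_normed_field^'m) \<Rightarrow> bool" where
  "is_frame N \<Phi> \<longleftrightarrow> vec.span (\<Phi> ` {1..N}) = UNIV"

definition unit_norm_frames :: "nat \<Rightarrow> (nat \<Rightarrow> 'a::real_normed_field^'m) set" where
  "unit_norm_frames N = {\<Phi>. is_frame N \<Phi> \<and> (\<forall>j\<in>{1..N}. norm (\<Phi> j) = 1)}"

definition is_tight ::
  "nat \<Rightarrow> (nat \<Rightarrow> 'a::{conjugatable_field,real_normed_field}^'m) \<Rightarrow> bool" where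
  "is_tight N \<Phi> \<longleftrightarrow> (\<exists>A::real. A > 0 \<and> (\<Sum>j=1..N. rank1 (\<Phi> j)) = A *\<^sub>R mat 1)"

text \<open>
  The norm of the type \<open>'a^'m^'m\<close> is the Euclidean norm of the array of matrix entries, that is,
  the Hilbert--Schmidt norm, so \<open>dist\<close> between matrices below is the Hilbert--Schmidt distance.
  The factor \<open>c\<close> is the global scaling up to which the embedding is isometric.
\<close>

definition isometric_sphere_embedding ::
  "nat \<Rightarrow> (nat \<Rightarrow> 'a::{conjugatable_field,real_normed_field}^'m) \<Rightarrow> (nat \<Rightarrow> real^'d) \<Rightarrow> bool" where
  "isometric_sphere_embedding N \<Phi> y \<longleftrightarrow>
     (\<forall>j\<in>{1..N}. y j \<in> sphere 0 1) \<and>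
     (\<exists>c>0. \<forall>j\<in>{1..N}. \<forall>l\<in>{1..N}. dist (y j) (y l) = c * dist (rank1 (\<Phi> j)) (rank1 (\<Phi> l)))"

end

theory Submission
  imports Defs
begin

text \<open>
  A unit vector \<open>\<phi>\<close> is replaced by the rank-one projection \<open>P = \<phi> \<phi>\<^sup>*\<close>, regarded as a point of the real
  inner product space of self-adjoint matrices with \<open>X \<bullet> Y = Re tr (X Y\<^sup>*)\<close>. In this space
  \<open>P\<^sub>j \<bullet> P\<^sub>l = |\<langle>\<phi>\<^sub>j, \<phi>\<^sub>l\<rangle>|\<^sup>2\<close>, while \<open>P\<^sub>j \<bullet> I = tr P\<^sub>j = 1\<close> and \<open>I \<bullet> I = M\<close>. So all \<open>P\<^sub>j\<close> lie in the affine
  hyperplane of trace-one matrices, on a sphere with centre \<open>I / M\<close> and squared radius \<open>1 - 1 / M\<close>.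
  Moving this centre to the origin and rescaling by \<open>sqrt (M / (M - 1))\<close> gives unit vectors in the
  space of traceless self-adjoint matrices, and their inner products are the required affine function
  of \<open>P\<^sub>j \<bullet> P\<^sub>l\<close>. Tightness says that the \<open>P\<^sub>j\<close> add up to a multiple of \<open>I\<close>; comparing traces, the
  centred vectors add up to zero.

  Any space of dimension at most \<open>D\<close> embeds linearly and isometrically into \<open>\<real>\<^sup>D\<close>, so it remains to
  count dimensions. Self-adjoint matrices have real dimension at most \<open>M\<^sup>2\<close> over \<open>\<complex>\<close>
  (\<open>dim_hermitian_le\<close>) and at most \<open>M (M + 1) / 2\<close> over \<open>\<real>\<close> (\<open>dim_symmetric_le\<close>), and the traceless
  ones have one dimension less. The centring argument depends only on the inner
  products above, so \<open>centred_isometric_embedding\<close> carries it out in an arbitrary Euclidean space and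
  serves both fields.
\<close>

section \<open>Centring points of an affine hyperplane\<close>

text \<open>
  For rank-one projections, \<open>e\<close> is the identity matrix and \<open>m\<close> its trace. The bound on \<open>dim H\<close>
  exceeds the target dimension by one because the centred points lie in the
  orthogonal complement of \<open>e\<close> in \<open>H\<close>.
\<close>

lemma centred_isometric_embedding:
  fixes P :: "nat \<Rightarrow> 'e::euclidean_space" and e :: 'e and H :: "'e set" and m a :: real
  assumes H: "subspace H" "dim H \<le> CARD('d::finite) + 1" "e \<in> H" "\<And>j. j \<in> J \<Longrightarrow> P j \<in> H"
    and m: "m > 1" "e \<bullet> e = m"
    and P: "\<And>j. j \<in> J \<Longrightarrow> P j \<bullet> P j = 1" "\<And>j. j \<in> J \<Longrightarrow> P j \<bullet> e = 1"
    and tight: "(\<Sum>j\<in>J. P j) = a *\<^sub>R e"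
  obtains y :: "nat \<Rightarrow> real^'d" and c :: real where
    "c > 0"
    "\<And>j. j \<in> J \<Longrightarrow> y j \<in> sphere 0 1"
    "\<And>j l. j \<in> J \<Longrightarrow> l \<in> J \<Longrightarrow> dist (y j) (y l) = c * dist (P j) (P l)"
    "\<And>j l. j \<in> J \<Longrightarrow> l \<in> J \<Longrightarrow> P j \<bullet> P l = 1 / m + (m - 1) / m * (y j \<bullet> y l)"
    "(\<Sum>j\<in>J. y j) = 0"
proof -
  define W where "W = H \<inter> {x. e \<bullet> x = 0}"
  define c where "c = sqrt (m / (m - 1))"
  define z where "z j = c *\<^sub>R (P j - (1 / m) *\<^sub>R e)" for j
  have c: "c > 0" "c * c = m / (m - 1)"
    using m by (auto simp: c_def)
  have W: "subspace W"
    unfolding W_def by (intro subspace_inter H subspace_hyperplane)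
  have "e \<noteq> 0"
    using m by auto
  \<comment> \<open>Centring takes place in \<open>W\<close>, which is smaller than \<open>H\<close> by the direction \<open>e\<close>.\<close>
  have "dim W + dim {e} = dim (W \<union> {e})"
    by (rule dim_orthogonal_sum[symmetric]) (auto simp: W_def inner_commute)
  also have "\<dots> \<le> dim H"
    using H by (intro dim_subset) (auto simp: W_def)
  finally have "dim W \<le> dim (UNIV :: (real^'d) set)"
    using H(2) \<open>e \<noteq> 0\<close> by simp
  then obtain f :: "'e \<Rightarrow> real^'d" where f: "linear f" "\<And>x. x \<in> W \<Longrightarrow> norm (f x) = norm x"
    using isometry_subset_subspace[OF W subspace_UNIV] by metis
  \<comment> \<open>A linear map that preserves norms on \<open>W\<close> preserves inner products there, by polarization.\<close>
  have norm_diff: "norm (f x - f y) = norm (x - y)" if "x \<in> W" "y \<in> W" for x y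
    using f(2)[of "x - y"] that W by (simp add: linear_diff[OF f(1)] subspace_diff)
  have inner_f: "f x \<bullet> f y = x \<bullet> y" if "x \<in> W" "y \<in> W" for x y
    using norm_diff[OF that] that f(2) by (simp add: dot_norm_neg)
  have zW: "z j \<in> W" if "j \<in> J" for j
    using that H P(2)[OF that] m
    by (auto simp: W_def z_def inner_diff_right inner_commute
        intro!: subspace_scale subspace_diff)
  have z_inner: "z j \<bullet> z l = m / (m - 1) * (P j \<bullet> P l - 1 / m)" if "j \<in> J" "l \<in> J" for j l
  proof -
    have "z j \<bullet> z l = (c * c) * ((P j - (1 / m) *\<^sub>R e) \<bullet> (P l - (1 / m) *\<^sub>R e))"
      by (simp add: z_def)
    also have "(P j - (1 / m) *\<^sub>R e) \<bullet> (P l - (1 / m) *\<^sub>R e) = P j \<bullet> P l - 1 / m"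
    proof -
      have "e \<bullet> P l = 1"
        using P(2)[OF that(2)] by (simp add: inner_commute)
      then show ?thesis
        using P(2)[OF that(1)] m by (simp add: inner_diff_left inner_diff_right)
    qed
    finally show ?thesis
      by (simp add: c)
  qed
  have z_sum: "(\<Sum>j\<in>J. z j) = 0"
  proof -
    \<comment> \<open>Pairing the tightness identity with \<open>e\<close> determines \<open>a\<close> as \<open>card J / m\<close>.\<close>
    have "real (card J) = (\<Sum>j\<in>J. P j \<bullet> e)"
      by (simp add: P(2))
    also have "\<dots> = a * m"
      using m by (simp add: tight flip: inner_sum_left)
    finally have "real (card J) = a * m" .
    then show ?thesis
      using m by (simp add: z_def sum_subtractf tight scaleR_sum_right[symmetric] sum_constant_scaleR)
  qed
  show ?thesis
  proof (rule that[of c "\<lambda>j. f (z j)"])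
    show "c > 0"
      by (rule c)
    show "f (z j) \<in> sphere 0 1" if "j \<in> J" for j
    proof -
      have "z j \<bullet> z j = 1"
        using z_inner[OF that that] P(1)[OF that] m by (simp add: field_simps)
      then show ?thesis
        using f(2)[OF zW[OF that]] by (simp add: norm_eq_1)
    qed
    show "dist (f (z j)) (f (z l)) = c * dist (P j) (P l)" if "j \<in> J" "l \<in> J" for j l
    proof -
      have "dist (f (z j)) (f (z l)) = norm (z j - z l)"
        using norm_diff zW that by (simp add: dist_norm)
      also have "z j - z l = c *\<^sub>R (P j - P l)"
        by (simp add: z_def algebra_simps)
      finally show ?thesis
        using c by (simp add: dist_norm)
    qed
    show "P j \<bullet> P l = 1 / m + (m - 1) / m * (f (z j) \<bullet> f (z l))" if "j \<in> J" "l \<in> J" for j l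
    proof -
      have "f (z j) \<bullet> f (z l) = m / (m - 1) * (P j \<bullet> P l - 1 / m)"
        using z_inner[OF that] inner_f zW that by simp
      then show ?thesis
        using m by simp
    qed
    show "(\<Sum>j\<in>J. f (z j)) = 0"
      using z_sum linear_sum[OF f(1), of z J] linear_0[OF f(1)] by simp
  qed
qed

section \<open>Dimensions of spaces of self-adjoint matrices\<close>

text \<open>
  Multiplication by \<open>\<i>\<close> maps Hermitian matrices injectively to skew-Hermitian ones, which are
  orthogonal to the Hermitian ones for the real inner product. Two orthogonal subspaces of equal
  dimension fit into a space of real dimension \<open>2 M\<^sup>2\<close>, so each has dimension at most \<open>M\<^sup>2\<close>.
\<close>

lemma dim_hermitian_le:
  "dim {X :: complex^'m^'m. \<forall>i j. cnj (X $ i $ j) = X $ j $ i} \<le> CARD('m)\<^sup>2"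
proof -
  let ?H = "{X :: complex^'m^'m. \<forall>i j. cnj (X $ i $ j) = X $ j $ i}"
  define J where "J X = (\<chi> i j. \<i> * X $ i $ j)" for X :: "complex^'m^'m"
  have "linear J"
    by (rule linearI) (auto simp: J_def vec_eq_iff algebra_simps scaleR_conv_of_real)
  moreover have "inj J"
    by (auto simp: J_def inj_def vec_eq_iff)
  ultimately have "dim (J ` ?H) = dim ?H"
    by (intro dim_image_eq) (auto intro: inj_on_subset)
  moreover have "X \<bullet> J Y = 0" if X: "X \<in> ?H" and Y: "Y \<in> ?H" for X Y
  proof -
    have "X \<bullet> J Y = (\<Sum>i\<in>UNIV. \<Sum>j\<in>UNIV. X $ i $ j \<bullet> (\<i> * Y $ i $ j))"
      by (simp add: inner_vec_def J_def)
    also have "\<dots> = (\<Sum>i\<in>UNIV. \<Sum>j\<in>UNIV. cnj (X $ j $ i) \<bullet> (\<i> * cnj (Y $ j $ i)))"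
    proof (intro sum.cong refl)
      fix i j
      show "X $ i $ j \<bullet> (\<i> * Y $ i $ j) = cnj (X $ j $ i) \<bullet> (\<i> * cnj (Y $ j $ i))"
        using X Y by simp
    qed
    also have "\<dots> = (\<Sum>i\<in>UNIV. \<Sum>j\<in>UNIV. cnj (X $ i $ j) \<bullet> (\<i> * cnj (Y $ i $ j)))"
      by (rule sum.swap)
    \<comment> \<open>Conjugation preserves the inner product but changes the sign of \<open>\<i>\<close>.\<close>
    also have "\<dots> = - (\<Sum>i\<in>UNIV. \<Sum>j\<in>UNIV. X $ i $ j \<bullet> (\<i> * Y $ i $ j))"
      by (simp add: inner_complex_def flip: sum_negf)
    also have "\<dots> = - (X \<bullet> J Y)"
      by (simp add: inner_vec_def J_def)
    finally show ?thesis by simp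
  qed
  then have "dim (?H \<union> J ` ?H) = dim ?H + dim (J ` ?H)"
    by (intro dim_orthogonal_sum) blast
  moreover have "dim (?H \<union> J ` ?H) \<le> 2 * CARD('m)\<^sup>2"
    using dim_subset_UNIV[of "?H \<union> J ` ?H"] by (simp add: power2_eq_square)
  ultimately show ?thesis by linarith
qed

text \<open>
  The entry of a symmetric matrix at \<open>(i, j)\<close> depends only on the unordered pair \<open>{i, j}\<close>. Hence the
  matrices \<open>E s\<close>, which mark the positions belonging to the set \<open>s\<close>, span the symmetric matrices
  as \<open>s\<close> runs over the sets of one or two indices.
\<close>

lemma dim_symmetric_le:
  "dim {X :: real^'m^'m. \<forall>i j. X $ i $ j = X $ j $ i} \<le> CARD('m) * (CARD('m) + 1) div 2"
proof -
  let ?H = "{X :: real^'m^'m. \<forall>i j. X $ i $ j = X $ j $ i}"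
  define E :: "'m set \<Rightarrow> real^'m^'m" where "E s = (\<chi> i j. if {i, j} = s then 1 else 0)" for s
  let ?S = "{s :: 'm set. s \<subseteq> UNIV \<and> card s = 1} \<union> {s. s \<subseteq> UNIV \<and> card s = 2}"
  have S: "{i, j} \<in> ?S" for i j :: 'm
    by (cases "i = j") auto
  have "X \<in> span (E ` ?S)" if X: "X \<in> ?H" for X
  proof -
    define x where "x s = (SOME r. \<exists>i j. s = {i, j} \<and> r = X $ i $ j)" for s
    \<comment> \<open>Symmetry makes the choice of an ordering of \<open>s\<close> immaterial.\<close>
    have x: "x {i, j} = X $ i $ j" for i j
      unfolding x_def using X by (intro some_equality) (auto simp: doubleton_eq_iff)
    have "X = (\<Sum>s\<in>?S. x s *\<^sub>R E s)"
      by (simp only: vec_eq_iff sum_component) (use S x in \<open>simp add: E_def if_distrib cong: if_cong\<close>)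
    also have "\<dots> \<in> span (E ` ?S)"
      by (intro span_sum span_scale span_base) auto
    finally show ?thesis .
  qed
  then have "dim ?H \<le> card (E ` ?S)"
    by (intro dim_le_card) auto
  also have "\<dots> \<le> card ?S"
    by (rule card_image_le) simp
  also have "\<dots> \<le> (CARD('m) choose 1) + (CARD('m) choose 2)"
    by (rule order_trans[OF card_Un_le]) (simp only: n_subsets finite)
  also have "\<dots> = CARD('m) * (CARD('m) + 1) div 2"
    by (cases "CARD('m)") (auto simp: choose_two)
  finally show ?thesis .
qed

section \<open>Inner products of rank-one projections\<close>

lemma inner_complex_Re: "u \<bullet> v = Re (u * cnj v)"
  by (simp add: inner_complex_def)

text \<open>
  \<open>tr (x x\<^sup>* y y\<^sup>*)\<close> factors as \<open>\<langle>x, y\<rangle>\<close> times its conjugate, so it is already real and taking the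
  real part loses nothing.
\<close>

lemma inner_rank1_complex:
  fixes x y :: "complex^'m"
  shows "rank1 x \<bullet> rank1 y = (cmod (hinner x y))\<^sup>2"
proof -
  have "complex_of_real ((cmod (hinner x y))\<^sup>2) = hinner x y * cnj (hinner x y)"
    by (rule complex_norm_square)
  also have "\<dots> = (\<Sum>i\<in>UNIV. \<Sum>j\<in>UNIV. (x $ i * cnj (x $ j)) * cnj (y $ i * cnj (y $ j)))"
    by (simp add: hinner_def sum_product mult_ac)
  finally have "(cmod (hinner x y))\<^sup>2 =
      Re (\<Sum>i\<in>UNIV. \<Sum>j\<in>UNIV. (x $ i * cnj (x $ j)) * cnj (y $ i * cnj (y $ j)))"
    by (metis Re_complex_of_real)
  then show ?thesis
    by (simp add: inner_vec_def rank1_def inner_complex_Re)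
qed

lemma inner_rank1_real:
  fixes x y :: "real^'m"
  shows "rank1 x \<bullet> rank1 y = \<bar>hinner x y\<bar>\<^sup>2"
  by (simp add: hinner_def rank1_def inner_vec_def power2_eq_square sum_product mult_ac)

lemma hinner_self_complex:
  fixes x :: "complex^'m"
  shows "hinner x x = complex_of_real ((norm x)\<^sup>2)"
  by (simp add: hinner_def norm_vec_def L2_set_def sum_nonneg flip: complex_norm_square)

lemma hinner_self_real:
  fixes x :: "real^'m"
  shows "hinner x x = (norm x)\<^sup>2"
  by (simp add: hinner_def power2_norm_eq_inner inner_vec_def)

lemma inner_mat_1:
  fixes X :: "'a::{real_normed_field,real_inner}^'m^'m"
  shows "X \<bullet> mat 1 = (\<Sum>i\<in>UNIV. X $ i $ i \<bullet> 1)"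
  by (simp add: inner_vec_def mat_def if_distrib cong: if_cong)

lemma inner_mat_1_self:
  "(mat 1 :: 'a::{real_normed_field,real_inner}^'m^'m) \<bullet> mat 1 = real CARD('m)"
  by (subst inner_mat_1) (simp add: mat_def dot_square_norm)

lemma inner_rank1_mat_1_complex:
  fixes x :: "complex^'m"
  shows "rank1 x \<bullet> mat 1 = (norm x)\<^sup>2"
proof -
  have "rank1 x \<bullet> mat 1 = Re (hinner x x)"
    by (simp add: inner_mat_1 rank1_def hinner_def)
  then show ?thesis
    by (simp add: hinner_self_complex)
qed

lemma inner_rank1_mat_1_real:
  fixes x :: "real^'m"
  shows "rank1 x \<bullet> mat 1 = (norm x)\<^sup>2"
  by (simp add: inner_mat_1 rank1_def flip: hinner_self_real) (simp add: hinner_def)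

section \<open>Tight frames on the unit sphere\<close>

theorem corollary3p2:
  fixes M N :: nat
  assumes "CARD('m::finite) = M" and "M \<ge> 2"
  shows
    "(\<forall>\<Phi> :: nat \<Rightarrow> complex^'m.
        CARD('c::finite) = M\<^sup>2 - 1 \<longrightarrow> \<Phi> \<in> unit_norm_frames N \<longrightarrow> is_tight N \<Phi> \<longrightarrow>
        (\<exists>y :: nat \<Rightarrow> real^'c.
           isometric_sphere_embedding N \<Phi> y \<and>
           (\<forall>j\<in>{1..N}. \<forall>l\<in>{1..N}.
              (cmod (hinner (\<Phi> j) (\<Phi> l)))\<^sup>2 = 1 / real M + (real M - 1) / real M * (y j \<bullet> y l)) \<and>
           (\<Sum>j=1..N. y j) = 0)) \<and>
     (\<forall>\<Phi> :: nat \<Rightarrow> real^'m.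
        CARD('r::finite) = (M + 2) * (M - 1) div 2 \<longrightarrow> \<Phi> \<in> unit_norm_frames N \<longrightarrow> is_tight N \<Phi> \<longrightarrow>
        (\<exists>y :: nat \<Rightarrow> real^'r.
           isometric_sphere_embedding N \<Phi> y \<and>
           (\<forall>j\<in>{1..N}. \<forall>l\<in>{1..N}.
              \<bar>hinner (\<Phi> j) (\<Phi> l)\<bar>\<^sup>2 = 1 / real M + (real M - 1) / real M * (y j \<bullet> y l)) \<and>
           (\<Sum>j=1..N. y j) = 0))"
proof (intro conjI allI impI)
  fix \<Phi> :: "nat \<Rightarrow> complex^'m"
  assume D: "CARD('c) = M\<^sup>2 - 1" and frame: "\<Phi> \<in> unit_norm_frames N" and "is_tight N \<Phi>"
  then obtain A where A: "(\<Sum>j=1..N. rank1 (\<Phi> j)) = A *\<^sub>R mat 1"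
    by (auto simp: is_tight_def)
  let ?H = "{X :: complex^'m^'m. \<forall>i j. cnj (X $ i $ j) = X $ j $ i}"
  have unit: "norm (\<Phi> j) = 1" if "j \<in> {1..N}" for j
    using frame that by (auto simp: unit_norm_frames_def)
  have H: "subspace ?H"
    by (simp add: subspace_def)
  have dim: "dim ?H \<le> CARD('c) + 1"
    using dim_hermitian_le[where 'm = 'm] assms D by simp
  have one: "mat 1 \<in> ?H"
    by (auto simp: mat_def)
  have rank1: "rank1 (\<Phi> j) \<in> ?H" for j
    by (simp add: rank1_def mult.commute)
  have M: "real M > 1" "(mat 1 :: complex^'m^'m) \<bullet> mat 1 = real M"
    using assms by (simp_all add: inner_mat_1_self)
  have unit_rank1: "rank1 (\<Phi> j) \<bullet> rank1 (\<Phi> j) = 1" "rank1 (\<Phi> j) \<bullet> mat 1 = 1"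
    if "j \<in> {1..N}" for j
    by (simp_all add: inner_rank1_complex hinner_self_complex inner_rank1_mat_1_complex unit[OF that])
  obtain y :: "nat \<Rightarrow> real^'c" and c where y: "c > 0"
    "\<And>j. j \<in> {1..N} \<Longrightarrow> y j \<in> sphere 0 1"
    "\<And>j l. j \<in> {1..N} \<Longrightarrow> l \<in> {1..N} \<Longrightarrow>
       dist (y j) (y l) = c * dist (rank1 (\<Phi> j)) (rank1 (\<Phi> l))"
    "\<And>j l. j \<in> {1..N} \<Longrightarrow> l \<in> {1..N} \<Longrightarrow>
       rank1 (\<Phi> j) \<bullet> rank1 (\<Phi> l) = 1 / real M + (real M - 1) / real M * (y j \<bullet> y l)"
    "(\<Sum>j=1..N. y j) = 0"
    by (rule centred_isometric_embedding[OF H dim one rank1 M unit_rank1 A]; (assumption | rule that))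
  show "\<exists>y :: nat \<Rightarrow> real^'c.
      isometric_sphere_embedding N \<Phi> y \<and>
      (\<forall>j\<in>{1..N}. \<forall>l\<in>{1..N}.
         (cmod (hinner (\<Phi> j) (\<Phi> l)))\<^sup>2 = 1 / real M + (real M - 1) / real M * (y j \<bullet> y l)) \<and>
      (\<Sum>j=1..N. y j) = 0"
    unfolding isometric_sphere_embedding_def inner_rank1_complex[symmetric] using y by blast
next
  fix \<Phi> :: "nat \<Rightarrow> real^'m"
  assume D: "CARD('r) = (M + 2) * (M - 1) div 2" and frame: "\<Phi> \<in> unit_norm_frames N" and "is_tight N \<Phi>"
  then obtain A where A: "(\<Sum>j=1..N. rank1 (\<Phi> j)) = A *\<^sub>R mat 1"
    by (auto simp: is_tight_def)
  let ?H = "{X :: real^'m^'m. \<forall>i j. X $ i $ j = X $ j $ i}"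
  have unit: "norm (\<Phi> j) = 1" if "j \<in> {1..N}" for j
    using frame that by (auto simp: unit_norm_frames_def)
  have H: "subspace ?H"
    by (simp add: subspace_def)
  have dim: "dim ?H \<le> CARD('r) + 1"
  proof -
    \<comment> \<open>There are \<open>(M + 2) (M - 1) / 2 + 1\<close> positions on and above the diagonal.\<close>
    have "(M + 2) * (M - 1) + 2 = M * (M + 1)"
      using assms(2) by (cases M) auto
    then have "CARD('r) + 1 = M * (M + 1) div 2"
      using D by (metis div_add_self2 zero_neq_numeral)
    then show ?thesis
      using dim_symmetric_le[where 'm = 'm] assms(1) by simp
  qed
  have one: "mat 1 \<in> ?H"
    by (auto simp: mat_def)
  have rank1: "rank1 (\<Phi> j) \<in> ?H" for j
    by (simp add: rank1_def mult.commute)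
  have M: "real M > 1" "(mat 1 :: real^'m^'m) \<bullet> mat 1 = real M"
    using assms by (simp_all add: inner_mat_1_self)
  have unit_rank1: "rank1 (\<Phi> j) \<bullet> rank1 (\<Phi> j) = 1" "rank1 (\<Phi> j) \<bullet> mat 1 = 1"
    if "j \<in> {1..N}" for j
    by (simp_all add: inner_rank1_real hinner_self_real inner_rank1_mat_1_real unit[OF that])
  obtain y :: "nat \<Rightarrow> real^'r" and c where y: "c > 0"
    "\<And>j. j \<in> {1..N} \<Longrightarrow> y j \<in> sphere 0 1"
    "\<And>j l. j \<in> {1..N} \<Longrightarrow> l \<in> {1..N} \<Longrightarrow>
       dist (y j) (y l) = c * dist (rank1 (\<Phi> j)) (rank1 (\<Phi> l))"
    "\<And>j l. j \<in> {1..N} \<Longrightarrow> l \<in> {1..N} \<Longrightarrow>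
       rank1 (\<Phi> j) \<bullet> rank1 (\<Phi> l) = 1 / real M + (real M - 1) / real M * (y j \<bullet> y l)"
    "(\<Sum>j=1..N. y j) = 0"
    by (rule centred_isometric_embedding[OF H dim one rank1 M unit_rank1 A]; (assumption | rule that))
  show "\<exists>y :: nat \<Rightarrow> real^'r.
      isometric_sphere_embedding N \<Phi> y \<and>
      (\<forall>j\<in>{1..N}. \<forall>l\<in>{1..N}.
         \<bar>hinner (\<Phi> j) (\<Phi> l)\<bar>\<^sup>2 = 1 / real M + (real M - 1) / real M * (y j \<bullet> y l)) \<and>
      (\<Sum>j=1..N. y j) = 0"
    unfolding isometric_sphere_embedding_def inner_rank1_real[symmetric] using y by blast
qed

end
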